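(* Let $G$ be a tree on $k$ vertices and $n\ge 1$. Then $$\begin{aligned}\mathrm{Sz}(\Gamma^G_n)&=\frac{2(k-1)^2(2k^2-2k-1)}{k^3(2k-1)}\,2^nk^{2n}-\frac{4(k-1)^2}{k^2}\,nk^{2n}+\frac{4(k+1)(k-1)}{k^3}\,k^{2n}-\frac{4(k+1)(k-1)}{k(2k-1)}\,k^n\\&\quad+\left(\frac{4}{k^2}\,nk^{2n}-\frac{2(k^2+2)}{k^3(k-1)}\,k^{2n}+\frac{2(k+2)}{k^2(k-1)}\,k^n\right)\mathrm{Sz}(G).\end{aligned}$$
   Context: Let $G=(V,E)$ be a finite tree with vertex set $V$ of size $k$, and fix an orientation of each edge, so that each edge becomes an ordered pair $e=(s,t)$. Each oriented edge $e=(s,t)$ acts on the set $V^*$ of finite words over the alphabet $V$ by the recursive rule: $e(\emptyset)=\emptyset$, $e(sw)=t\,e(w)$, $e(tw)=sw$, and $e(xw)=xw$ for $x\in V\setminus\{s,t\}$ (words are read left to right, $w\in V^*$). This action preserves word length. For $n\ge 1$, the Schreier graph $\Gamma_n^G$ is the multigraph with vertex set $V^n$ having, for each $u\in V^n$ and each oriented edge $e$ of $G$, one edge joining $u$ and $e(u)$, labelled $e$ (a loop if $e(u)=u$). For vertices $u,v$ of a connected graph $H$, $n(u,v)$ is the number of vertices of $H$ strictly closer to $u$ than to $v$. The Szeged index is $\mathrm{Sz}(H)=\sum_{\{u,v\}}n(u,v)\,n(v,u)$, the sum over all non-loop edges $\{u,v\}$ of $H$, parallel edges counted with multiplicity (loops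 contribute nothing). *)

theory Defs
  imports Complex_Main
begin

text \<open>Undirected adjacency (symmetric closure) of an oriented edge set.\<close>
definition sym_edges :: "('a \<times> 'a) set \<Rightarrow> ('a \<times> 'a) set" where
  "sym_edges E = E \<union> E\<inverse>"

text \<open>A finite tree on vertex set V whose edges are given with a fixed orientation:
  each undirected edge appears exactly once as an ordered pair, no loops,
  connected, and acyclic (every edge is a bridge: removing it disconnects its endpoints).\<close>
definition oriented_tree :: "'a set \<Rightarrow> ('a \<times> 'a) set \<Rightarrow> bool" where
  "oriented_tree V E \<longleftrightarrow>
     finite V \<and> V \<noteq> {} \<and> E \<subseteq> V \<times> V \<and>
     (\<forall>(s,t)\<in>E. s \<noteq> t \<and> (t,s) \<notin> E) \<and>
     (\<forall>u\<in>V. \<forall>v\<in>V. (u,v) \<in> (sym_edges E)\<^sup>*) \<and>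
     (\<forall>(s,t)\<in>E. (s,t) \<notin> (sym_edges (E - {(s,t)}))\<^sup>*)"

text \<open>Action of an oriented edge (s,t) on words.\<close>
fun edge_act :: "'a \<times> 'a \<Rightarrow> 'a list \<Rightarrow> 'a list" where
  "edge_act e [] = []"
| "edge_act (s,t) (x # w) =
     (if x = s then t # edge_act (s,t) w
      else if x = t then s # w
      else x # w)"

text \<open>Graph distance w.r.t. an adjacency relation R (number of steps of a shortest walk).\<close>
definition gdist :: "('a \<times> 'a) set \<Rightarrow> 'a \<Rightarrow> 'a \<Rightarrow> nat" where
  "gdist R u v = (LEAST m. (u,v) \<in> R ^^ m)"

text \<open>n(u,v): number of vertices strictly closer to u than to v.\<close>
definition ncloser :: "'a set \<Rightarrow> ('a \<times> 'a) set \<Rightarrow> 'a \<Rightarrow> 'a \<Rightarrow> nat" where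
  "ncloser VV R u v = card {w \<in> VV. gdist R w u < gdist R w v}"

text \<open>Szeged index of the tree G = (V,E) (each edge counted once).\<close>
definition szeged_tree :: "'a set \<Rightarrow> ('a \<times> 'a) set \<Rightarrow> nat" where
  "szeged_tree V E =
     (\<Sum>(s,t)\<in>E. ncloser V (sym_edges E) s t * ncloser V (sym_edges E) t s)"

text \<open>Schreier graph Gamma_n: vertex set V^n (words of length n).\<close>
definition schreier_verts :: "'a set \<Rightarrow> nat \<Rightarrow> 'a list set" where
  "schreier_verts V n = {w. length w = n \<and> set w \<subseteq> V}"

text \<open>Adjacency of Gamma_n (u adjacent to e(u) for each oriented edge e; symmetric).\<close>
definition schreier_adj :: "'a set \<Rightarrow> ('a \<times> 'a) set \<Rightarrow> nat \<Rightarrow> ('a list \<times> 'a list) set" where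
  "schreier_adj V E n =
     {(u, v). u \<in> schreier_verts V n \<and> v \<in> schreier_verts V n \<and>
              (\<exists>e\<in>E. v = edge_act e u \<or> u = edge_act e v)}"

text \<open>Szeged index of the multigraph Gamma_n: one edge {u, e(u)} for each word u and each
  oriented edge e; loops (e(u) = u) contribute nothing.\<close>
definition szeged_schreier :: "'a set \<Rightarrow> ('a \<times> 'a) set \<Rightarrow> nat \<Rightarrow> nat" where
  "szeged_schreier V E n =
     (\<Sum>u\<in>schreier_verts V n. \<Sum>e\<in>E.
        (if edge_act e u = u then 0
         else ncloser (schreier_verts V n) (schreier_adj V E n) u (edge_act e u) *
              ncloser (schreier_verts V n) (schreier_adj V E n) (edge_act e u) u))"

end

theory Submission
  imports Defs
begin

text \<open>
  An edge \<open>e = (s, t)\<close> acts on the words over \<open>{s, t}\<close> as a binary odometer, so its orbits are the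
  cycles \<open>{p @ y | p}\<close>, where \<open>p\<close> runs through the words of length \<open>m\<close> over \<open>{s, t}\<close> and \<open>y\<close> is a
  fixed suffix that does not start with \<open>s\<close> or \<open>t\<close>. The Schreier graph is a cactus whose blocks
  are these cycles: it retracts onto each of them. Following the retraction by the reflection
  of the cycle that swaps the end points of a given edge shows that the vertices closer to one
  end point are exactly those retracting to the corresponding half of the cycle. A half cycle
  contains exactly one of two antipodal points, hence the size of its preimage depends only on
  which of the constant words \<open>s ... s\<close> and \<open>t ... t\<close> it contains, and on the sizes \<open>a\<close>, \<open>b\<close> of
  the two components of the tree without \<open>e\<close>. Summing over all cycles leaves geometric series
  whose coefficients are polynomials in \<open>k = a + b\<close> and \<open>a b\<close>; finally \<open>a b\<close> sums to the Szeged
  index of the tree over its \<open>k - 1\<close> edges.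
\<close>

section \<open>Comparing distances by reflecting walks\<close>

section \<open>Reflections\<close>

text \<open>Each step of a walk is either collapsed or mapped to a step, so the image of the walk
  cannot be longer.\<close>

lemma relpow_weak_hom:
  assumes hom: "\<And>x y. (x, y) \<in> R \<Longrightarrow> \<rho> x = \<rho> y \<or> (\<rho> x, \<rho> y) \<in> R"
    and "(x, y) \<in> R ^^ d"
  shows "\<exists>d'\<le>d. (\<rho> x, \<rho> y) \<in> R ^^ d'"
  using assms(2)
proof (induction d arbitrary: x)
  case 0
  then show ?case by auto
next
  case (Suc d)
  then obtain z where z: "(x, z) \<in> R" "(z, y) \<in> R ^^ d"
    by (meson relpow_Suc_D2)
  from Suc.IH[OF z(2)] obtain d' where d': "d' \<le> d" "(\<rho> z, \<rho> y) \<in> R ^^ d'" by blast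
  from hom[OF z(1)] show ?case
  proof
    assume "\<rho> x = \<rho> z"
    with d' show ?thesis by (intro exI[of _ d']) simp
  next
    assume "(\<rho> x, \<rho> z) \<in> R"
    with d' show ?thesis by (meson Suc_le_mono relpow_Suc_I2)
  qed
qed

text \<open>A walk leaving \<open>H\<close> can be reflected from its first crossing on, which saves one step.\<close>
lemma relpow_reflect:
  assumes hom: "\<And>x y. (x, y) \<in> R \<Longrightarrow> \<rho> x = \<rho> y \<or> (\<rho> x, \<rho> y) \<in> R"
    and cross: "\<And>x y. (x, y) \<in> R \<Longrightarrow> x \<in> H \<Longrightarrow> y \<notin> H \<Longrightarrow> \<rho> y = x"
    and "(x, y) \<in> R ^^ d" "x \<in> H" "y \<notin> H"
  shows "\<exists>d'<d. (x, \<rho> y) \<in> R ^^ d'"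
  using assms(3,4)
proof (induction d arbitrary: x)
  case 0
  with \<open>y \<notin> H\<close> show ?case by auto
next
  case (Suc d)
  then obtain z where z: "(x, z) \<in> R" "(z, y) \<in> R ^^ d"
    by (meson relpow_Suc_D2)
  show ?case
  proof (cases "z \<in> H")
    case True
    from Suc.IH[OF z(2) True] obtain d' where d': "d' < d" "(z, \<rho> y) \<in> R ^^ d'" by blast
    with z(1) show ?thesis by (meson Suc_less_eq relpow_Suc_I2)
  next
    case False
    have "\<rho> z = x" using cross z(1) Suc.prems(2) False by blast
    with relpow_weak_hom[of R \<rho>, OF hom z(2)] show ?thesis by (auto simp: less_Suc_eq_le)
  qed
qed

text \<open>Reflecting a shortest walk shortens it. Connectedness enters because the
  \<open>LEAST\<close> in \<open>gdist\<close> describes a walk only when one exists.\<close>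

lemma gdist_reflect_less:
  assumes hom: "\<And>x y. (x, y) \<in> R \<Longrightarrow> \<rho> x = \<rho> y \<or> (\<rho> x, \<rho> y) \<in> R"
    and cross: "\<And>x y. (x, y) \<in> R \<Longrightarrow> x \<in> H \<Longrightarrow> y \<notin> H \<Longrightarrow> \<rho> y = x"
    and "(w, v) \<in> R\<^sup>*" "w \<in> H" "v \<notin> H"
  shows "gdist R w (\<rho> v) < gdist R w v"
proof -
  have "\<exists>m. (w, v) \<in> R ^^ m" using assms(3) rtrancl_imp_relpow by fast
  then have "(w, v) \<in> R ^^ gdist R w v" unfolding gdist_def by (rule LeastI_ex)
  then obtain d' where "d' < gdist R w v" "(w, \<rho> v) \<in> R ^^ d'"
    using relpow_reflect[of R \<rho> H, OF hom cross _ assms(4,5)] by blast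
  then show ?thesis unfolding gdist_def by (meson Least_le order.strict_trans1)
qed

text \<open>The reflection is used for \<open>H\<close> and, with \<open>u\<close> and
  \<open>v\<close> exchanged, for its complement. So no vertex is equidistant.\<close>

lemma ncloser_reflect:
  assumes hom: "\<And>x y. (x, y) \<in> R \<Longrightarrow> \<rho> x = \<rho> y \<or> (\<rho> x, \<rho> y) \<in> R"
    and cross: "\<And>x y. (x, y) \<in> R \<Longrightarrow> (x \<in> H) \<noteq> (y \<in> H) \<Longrightarrow> \<rho> x = y \<and> \<rho> y = x"
    and conn: "\<And>x y. x \<in> VV \<Longrightarrow> y \<in> VV \<Longrightarrow> (x, y) \<in> R\<^sup>*"
    and "\<rho> u = v" "\<rho> v = u" "u \<in> VV" "v \<in> VV" "u \<in> H" "v \<notin> H"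
  shows "ncloser VV R u v = card (VV \<inter> H)" "ncloser VV R v u = card (VV - H)"
proof -
  have 1: "gdist R w u < gdist R w v" if "w \<in> VV" "w \<in> H" for w
    using gdist_reflect_less[of R \<rho> H w v] hom cross conn[OF that(1) \<open>v \<in> VV\<close>] that assms by metis
  have 2: "gdist R w v < gdist R w u" if "w \<in> VV" "w \<notin> H" for w
    using gdist_reflect_less[of R \<rho> "- H" w u] hom cross conn[OF that(1) \<open>u \<in> VV\<close>] that assms
    by (metis ComplD ComplI)
  have "{w \<in> VV. gdist R w u < gdist R w v} = VV \<inter> H"
    using 1 2 by (auto dest: order.asym)
  then show "ncloser VV R u v = card (VV \<inter> H)" by (simp add: ncloser_def)
  have "{w \<in> VV. gdist R w v < gdist R w u} = VV - H"
    using 1 2 by (auto dest: order.asym)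
  then show "ncloser VV R v u = card (VV - H)" by (simp add: ncloser_def)
qed

section \<open>Cutting a tree at an edge and counting its edges\<close>

section \<open>Trees\<close>

lemma sym_edges_iff: "(x, y) \<in> sym_edges E \<longleftrightarrow> (x, y) \<in> E \<or> (y, x) \<in> E"
  by (auto simp: sym_edges_def)

lemma sym_sym_edges: "sym (sym_edges E)"
  by (auto simp: sym_def sym_edges_def)

lemma rtrancl_sym_edges_mono: "E \<subseteq> F \<Longrightarrow> (sym_edges E)\<^sup>* \<subseteq> (sym_edges F)\<^sup>*"
  by (rule rtrancl_mono) (auto simp: sym_edges_def)

text \<open>What is kept of the tree once an edge is chosen: \<open>S\<close> is the side of
  \<open>s\<close>, and only \<open>(s, t)\<close> crosses between the two sides.\<close>

locale edge_cut =
  fixes V :: "'a set" and E :: "('a \<times> 'a) set" and s t :: 'a and S :: "'a set"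
  assumes finite_V: "finite V"
    and E_V: "E \<subseteq> V \<times> V"
    and edge: "(s, t) \<in> E"
    and S_V: "S \<subseteq> V"
    and s_S: "s \<in> S"
    and t_S: "t \<notin> S"
    and same_side: "(x, y) \<in> E \<Longrightarrow> (x, y) \<noteq> (s, t) \<Longrightarrow> x \<in> S \<longleftrightarrow> y \<in> S"
    and conn: "u \<in> V \<Longrightarrow> v \<in> V \<Longrightarrow> (u, v) \<in> (sym_edges E)\<^sup>*"
begin

lemma s_V: "s \<in> V" and t_V: "t \<in> V" and s_t: "s \<noteq> t"
  using edge E_V s_S t_S by auto

text \<open>The reflection collapses each side of the tree onto its end point of the edge and then
  swaps \<open>s\<close> and \<open>t\<close>.\<close>

lemma ncloser_tree:
  "ncloser V (sym_edges E) s t = card S" "ncloser V (sym_edges E) t s = card (V - S)"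
proof -
  let ?\<rho> = "\<lambda>x. if x \<in> S then t else s"
  have hom: "?\<rho> x = ?\<rho> y \<or> (?\<rho> x, ?\<rho> y) \<in> sym_edges E" if "(x, y) \<in> sym_edges E" for x y
    using edge by (auto simp: sym_edges_iff)
  have cross: "?\<rho> x = y \<and> ?\<rho> y = x" if "(x, y) \<in> sym_edges E" "(x \<in> S) \<noteq> (y \<in> S)" for x y
    using that same_side[of x y] same_side[of y x] s_S t_S unfolding sym_edges_iff by auto
  have "V \<inter> S = S" using S_V by auto
  then show "ncloser V (sym_edges E) s t = card S" "ncloser V (sym_edges E) t s = card (V - S)"
    using ncloser_reflect[of "sym_edges E" ?\<rho> S V s t, OF hom cross conn] s_S t_S s_V t_V by auto
qed

end

text \<open>\<open>S\<close> is the component of \<open>s\<close> after deleting the edge. The two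
  reachability clauses serve the induction that counts edges.\<close>

lemma oriented_tree_edge_cut:
  assumes T: "oriented_tree V E" and e: "(s, t) \<in> E"
  obtains S where "edge_cut V E s t S"
    and "\<forall>x\<in>S. (s, x) \<in> (sym_edges (E - {(s, t)}))\<^sup>*"
    and "\<forall>x\<in>V - S. (t, x) \<in> (sym_edges (E - {(s, t)}))\<^sup>*"
proof -
  let ?R = "sym_edges (E - {(s, t)})"
  define S where "S = {x \<in> V. (s, x) \<in> ?R\<^sup>*}"
  have EV: "E \<subseteq> V \<times> V" and fin: "finite V"
    and conn: "\<And>u v. u \<in> V \<Longrightarrow> v \<in> V \<Longrightarrow> (u, v) \<in> (sym_edges E)\<^sup>*"
    and bridge: "(s, t) \<notin> ?R\<^sup>*"
    using T e unfolding oriented_tree_def by auto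
  have side: "(x \<in> S) = (y \<in> S)" if "(x, y) \<in> E" "(x, y) \<noteq> (s, t)" for x y
  proof -
    have "(x, y) \<in> ?R" "(y, x) \<in> ?R" using that by (auto simp: sym_edges_iff)
    then show ?thesis using that(1) EV unfolding S_def by (auto intro: rtrancl_into_rtrancl)
  qed
  have "edge_cut V E s t S"
    using EV fin conn bridge side e by unfold_locales (auto simp: S_def)
  moreover have "(s, x) \<in> ?R\<^sup>*" if "x \<in> S" for x
    using that by (simp add: S_def)
  moreover have "(t, x) \<in> ?R\<^sup>*" if "x \<in> V - S" for x
  proof -
    have "(s, x) \<in> (sym_edges E)\<^sup>*" using conn that e EV by auto
    \<comment> \<open>A walk that uses the deleted edge lands on \<open>s\<close> or
      \<open>t\<close>, from where a walk avoiding that edge can start afresh.\<close>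
    then have "(s, x) \<in> ?R\<^sup>* \<or> (t, x) \<in> ?R\<^sup>*"
    proof induction
      case base
      then show ?case by simp
    next
      case (step y z)
      show ?case
      proof (cases "(y, z) \<in> ?R")
        case True
        with step.IH show ?thesis by (auto intro: rtrancl_into_rtrancl)
      next
        case False
        then have "z = s \<or> z = t" using step.hyps(2) by (auto simp: sym_edges_iff)
        then show ?thesis by auto
      qed
    qed
    then show ?thesis using that by (auto simp: S_def)
  qed
  ultimately show ?thesis using that[of S] by blast
qed

text \<open>A walk that avoids the deleted edge never leaves \<open>A\<close>, so \<open>A\<close>
  is connected by its own edges; with fewer edges present, bridges stay bridges.\<close>

lemma oriented_tree_side:
  assumes T: "oriented_tree V E" and e: "(s, t) \<in> E" and "A \<subseteq> V" and "r \<in> A"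
    and side: "\<And>x y. (x, y) \<in> E \<Longrightarrow> (x, y) \<noteq> (s, t) \<Longrightarrow> x \<in> A \<longleftrightarrow> y \<in> A"
    and reach: "\<And>x. x \<in> A \<Longrightarrow> (r, x) \<in> (sym_edges (E - {(s, t)}))\<^sup>*"
  shows "oriented_tree A (E \<inter> A \<times> A)"
proof -
  let ?R = "sym_edges (E \<inter> A \<times> A)"
  have r: "(r, x) \<in> ?R\<^sup>*" if "x \<in> A" for x
  proof -
    have "(r, x) \<in> ?R\<^sup>* \<and> x \<in> A" using reach[OF that]
    proof induction
      case base
      then show ?case using \<open>r \<in> A\<close> by simp
    next
      case (step y z)
      then have "z \<in> A" using side[of y z] side[of z y] by (auto simp: sym_edges_iff)
      with step have "(y, z) \<in> ?R" by (auto simp: sym_edges_iff)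
      with step \<open>z \<in> A\<close> show ?case by (auto intro: rtrancl_into_rtrancl)
    qed
    then show ?thesis by simp
  qed
  have "(x, y) \<in> ?R\<^sup>*" if "x \<in> A" "y \<in> A" for x y
    using r[OF that(1)] r[OF that(2)] sym_rtrancl[OF sym_sym_edges, of "E \<inter> A \<times> A"]
    by (meson rtrancl_trans symD)
  moreover have "(x, y) \<notin> (sym_edges (E \<inter> A \<times> A - {(x, y)}))\<^sup>*" if "(x, y) \<in> E" for x y
  proof -
    have "(x, y) \<notin> (sym_edges (E - {(x, y)}))\<^sup>*" using T that unfolding oriented_tree_def by auto
    moreover have "E \<inter> A \<times> A - {(x, y)} \<subseteq> E - {(x, y)}" by auto
    ultimately show ?thesis using rtrancl_sym_edges_mono by blast
  qed
  ultimately show ?thesis using T \<open>A \<subseteq> V\<close> \<open>r \<in> A\<close> unfolding oriented_tree_def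
    by (auto dest: finite_subset)
qed

text \<open>An edge splits the tree into two smaller trees, so strong induction on the number of
  vertices applies. This supplies a factor \<open>k - 1\<close> in the final formula.\<close>

lemma oriented_tree_card:
  "oriented_tree V E \<Longrightarrow> card V = Suc (card E)"
proof (induction "card V" arbitrary: V E rule: less_induct)
  case less
  have fin: "finite V" and ne: "V \<noteq> {}" and EV: "E \<subseteq> V \<times> V"
    and conn: "\<And>u v. u \<in> V \<Longrightarrow> v \<in> V \<Longrightarrow> (u, v) \<in> (sym_edges E)\<^sup>*"
    using less.prems unfolding oriented_tree_def by auto
  have finE: "finite E" using fin EV by (meson finite_SigmaI finite_subset)
  show ?case
  proof (cases "E = {}")
    case True
    obtain v where "v \<in> V" using ne by auto
    moreover have "w = v" if "w \<in> V" for w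
      using conn[OF that \<open>v \<in> V\<close>] True by (simp add: sym_edges_def)
    ultimately have "V = {v}" by blast
    then show ?thesis using True by simp
  next
    case False
    then obtain s t where e: "(s, t) \<in> E" by auto
    obtain S where "edge_cut V E s t S"
      and rs: "\<forall>x\<in>S. (s, x) \<in> (sym_edges (E - {(s, t)}))\<^sup>*"
      and rt: "\<forall>x\<in>V - S. (t, x) \<in> (sym_edges (E - {(s, t)}))\<^sup>*"
      using oriented_tree_edge_cut[OF less.prems e] by blast
    then interpret edge_cut V E s t S by simp
    let ?A = "E \<inter> S \<times> S" and ?B = "E \<inter> (V - S) \<times> (V - S)"
    have "oriented_tree S ?A"
      using oriented_tree_side[OF less.prems e S_V s_S same_side] rs by blast
    moreover have "card S < card V" using S_V t_S t_V finite_V by (intro psubset_card_mono) auto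
    ultimately have 1: "card S = Suc (card ?A)" using less.hyps by blast
    have "oriented_tree (V - S) ?B"
    proof (rule oriented_tree_side[OF less.prems e])
      show "x \<in> V - S \<longleftrightarrow> y \<in> V - S" if "(x, y) \<in> E" "(x, y) \<noteq> (s, t)" for x y
        using same_side[OF that] E_V that by auto
    qed (use t_S t_V rt in auto)
    moreover have "card (V - S) < card V" using S_V s_S s_V finite_V
      by (intro psubset_card_mono) auto
    ultimately have 2: "card (V - S) = Suc (card ?B)" using less.hyps by blast
    have "E = insert (s, t) (?A \<union> ?B)"
    proof
      show "E \<subseteq> insert (s, t) (?A \<union> ?B)"
      proof
        fix f
        assume "f \<in> E"
        then show "f \<in> insert (s, t) (?A \<union> ?B)"
          using same_side[of "fst f" "snd f"] E_V by (cases f) auto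
      qed
    qed (use e in auto)
    then have "card E = card (insert (s, t) (?A \<union> ?B))" by simp
    also have "\<dots> = Suc (card (?A \<union> ?B))" using finE t_S s_S by (subst card_insert_disjoint) auto
    also have "card (?A \<union> ?B) = card ?A + card ?B"
      using finE by (subst card_Un_disjoint) auto
    finally have "card E = Suc (card ?A + card ?B)" .
    moreover have "card V = card S + card (V - S)"
      using card_Diff_subset[of S V] S_V fin by (simp add: card_mono finite_subset)
    ultimately show ?thesis using 1 2 by simp
  qed
qed

section \<open>The action of an edge, and sums over words\<close>

section \<open>Words\<close>

lemma length_edge_act [simp]: "length (edge_act e w) = length w"
  by (induction e w rule: edge_act.induct) auto

text \<open>The recursion continues only past a letter \<open>s\<close>, so a carry reaches
  \<open>v\<close> exactly when \<open>u\<close> has no other letters.\<close>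

lemma edge_act_append:
  "edge_act (s, t) (u @ v) =
     edge_act (s, t) u @ (if u = replicate (length u) s then edge_act (s, t) v else v)"
  by (induction u) auto

lemma edge_act_replicate: "edge_act (s, t) (replicate m s) = replicate m t"
  by (induction m) auto

lemma set_edge_act: "set (edge_act (s, t) w) \<subseteq> insert s (insert t (set w))"
  by (induction w) auto

text \<open>Serves the invariance of the retraction below: all change is confined to a block whose
  letters are end points of the edge.\<close>

lemma edge_act_prefix:
  obtains q q' r where "w = q @ r" "edge_act (s, t) w = q' @ r" "length q' = length q"
    "set q \<subseteq> {s, t}" "set q' \<subseteq> {s, t}"
proof (induction w arbitrary: thesis)
  case Nil
  show ?case by (rule Nil[of "[]" "[]" "[]"]) auto
next
  case (Cons x w)
  show ?case
  proof (cases "x = s")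
    case True
    obtain q q' r where "w = q @ r" "edge_act (s, t) w = q' @ r" "length q' = length q"
      "set q \<subseteq> {s, t}" "set q' \<subseteq> {s, t}"
      by (rule Cons.IH)
    then show ?thesis using True by (intro Cons.prems[of "x # q" r "t # q'"]) auto
  next
    case False
    show ?thesis
    proof (cases "x = t")
      case True
      with False show ?thesis by (intro Cons.prems[of "[x]" w "[s]"]) auto
    next
      case False': False
      with False show ?thesis by (intro Cons.prems[of "[]" "x # w" "[]"]) auto
    qed
  qed
qed

lemma schreier_verts_0: "schreier_verts V 0 = {[]}"
  by (auto simp: schreier_verts_def)

lemma Cons_in_schreier_verts:
  "x # w \<in> schreier_verts V (Suc n) \<longleftrightarrow> x \<in> V \<and> w \<in> schreier_verts V n"
  by (auto simp: schreier_verts_def)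

lemma edge_act_in_schreier_verts:
  "s \<in> V \<Longrightarrow> t \<in> V \<Longrightarrow> w \<in> schreier_verts V n \<Longrightarrow> edge_act (s, t) w \<in> schreier_verts V n"
  using set_edge_act[of s t w] by (auto simp: schreier_verts_def)

lemma finite_schreier_verts: "finite V \<Longrightarrow> finite (schreier_verts V n)"
  using finite_lists_length_eq[of V n] by (simp add: schreier_verts_def conj_commute)

lemma card_schreier_verts: "finite V \<Longrightarrow> card (schreier_verts V n) = card V ^ n"
  using card_lists_length_eq[of V n] by (simp add: schreier_verts_def conj_commute)

lemma schreier_verts_Suc:
  "schreier_verts V (Suc n) = (\<lambda>(x, w). x # w) ` (V \<times> schreier_verts V n)"
  by (auto simp: schreier_verts_def length_Suc_conv image_iff)

lemma schreier_verts_Suc_snoc: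
  "schreier_verts V (Suc n) = (\<lambda>(w, x). w @ [x]) ` (schreier_verts V n \<times> V)"
proof -
  have "w \<in> (\<lambda>(w, x). w @ [x]) ` (schreier_verts V n \<times> V)"
    if "w \<in> schreier_verts V (Suc n)" for w
    using that by (cases w rule: rev_cases) (auto simp: schreier_verts_def)
  then show ?thesis by (auto simp: schreier_verts_def)
qed

lemma sum_schreier_verts_Suc:
  "(\<Sum>w\<in>schreier_verts V (Suc n). f w) = (\<Sum>x\<in>V. \<Sum>w\<in>schreier_verts V n. f (x # w))"
  unfolding schreier_verts_Suc sum.cartesian_product
  by (subst sum.reindex) (auto simp: inj_on_def intro!: sum.cong)

text \<open>Words are sorted by their longest prefix over \<open>A\<close>. For
  \<open>A = {s, t}\<close> this groups them by the cycles of the odometer.\<close>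

lemma sum_schreier_verts_prefix:
  fixes f :: "'a list \<Rightarrow> 'b::comm_monoid_add"
  assumes "finite V" "A \<subseteq> V"
  shows "(\<Sum>w\<in>schreier_verts V n. f w) = (\<Sum>p\<in>schreier_verts A n. f p) +
    (\<Sum>m<n. \<Sum>p\<in>schreier_verts A m. \<Sum>x\<in>V - A. \<Sum>z\<in>schreier_verts V (n - Suc m). f (p @ x # z))"
proof (induction n arbitrary: f)
  case 0
  then show ?case by (simp add: schreier_verts_0)
next
  case (Suc n)
  let ?g = "\<lambda>x m. \<Sum>p\<in>schreier_verts A m. \<Sum>y\<in>V - A. \<Sum>z\<in>schreier_verts V (n - Suc m). f (x # p @ y # z)"
  have "(\<Sum>w\<in>schreier_verts V (Suc n). f w)
      = (\<Sum>x\<in>V - A. \<Sum>w\<in>schreier_verts V n. f (x # w)) + (\<Sum>x\<in>A. \<Sum>w\<in>schreier_verts V n. f (x # w))"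
    unfolding sum_schreier_verts_Suc using assms by (intro sum.subset_diff)
  also have "(\<Sum>x\<in>A. \<Sum>w\<in>schreier_verts V n. f (x # w))
      = (\<Sum>x\<in>A. \<Sum>p\<in>schreier_verts A n. f (x # p)) + (\<Sum>x\<in>A. \<Sum>m<n. ?g x m)"
    by (simp add: Suc.IH sum.distrib)
  also have "(\<Sum>x\<in>A. \<Sum>m<n. ?g x m) = (\<Sum>m<n. \<Sum>x\<in>A. ?g x m)"
    by (rule sum.swap)
  finally show ?case
    unfolding sum.lessThan_Suc_shift sum_schreier_verts_Suc schreier_verts_0
    by (simp add: add_ac)
qed

section \<open>Connectedness of the Schreier graph\<close>

lemma sym_schreier_adj: "sym (schreier_adj V E n)"
  by (auto simp: sym_def schreier_adj_def)

text \<open>By induction on the length: the first letter can be moved freely along the tree, and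
  bringing it to the source of an edge lets that edge act on the tail.\<close>

lemma schreier_connected:
  assumes EV: "E \<subseteq> V \<times> V"
    and conn: "\<And>u v. u \<in> V \<Longrightarrow> v \<in> V \<Longrightarrow> (u, v) \<in> (sym_edges E)\<^sup>*"
  shows "u \<in> schreier_verts V n \<Longrightarrow> v \<in> schreier_verts V n \<Longrightarrow> (u, v) \<in> (schreier_adj V E n)\<^sup>*"
proof (induction n arbitrary: u v)
  case 0
  then show ?case by (simp add: schreier_verts_0)
next
  case (Suc n)
  let ?R = "(schreier_adj V E (Suc n))\<^sup>*"
  have sym: "(a, b) \<in> ?R \<Longrightarrow> (b, a) \<in> ?R" for a b
    using sym_rtrancl[OF sym_schreier_adj] by (meson symD)
  have trans: "(a, b) \<in> ?R \<Longrightarrow> (b, c) \<in> ?R \<Longrightarrow> (a, c) \<in> ?R" for a b c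
    by (rule rtrancl_trans)
  have act: "(w, edge_act (a, b) w) \<in> ?R" if "(a, b) \<in> E" "w \<in> schreier_verts V (Suc n)" for a b w
    using that EV edge_act_in_schreier_verts[of a V b w "Suc n"]
    by (intro r_into_rtrancl) (auto simp: schreier_adj_def)
  \<comment> \<open>Applied to \<open>b # w\<close>, the edge rewrites only the first letter, with
    no carry into \<open>w\<close>.\<close>
  have edge: "(a # w, b # w) \<in> ?R" if "(a, b) \<in> E" "w \<in> schreier_verts V n" for a b w
  proof (cases "a = b")
    case False
    have "b # w \<in> schreier_verts V (Suc n)" using that EV by (auto simp: Cons_in_schreier_verts)
    from act[OF that(1) this] False show ?thesis by (auto intro: sym)
  qed simp
  have first: "(x # w, y # w) \<in> ?R" if "x \<in> V" "y \<in> V" "w \<in> schreier_verts V n" for x y w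
    using conn[OF that(1,2)]
  proof induction
    case (step y z)
    then show ?case using edge that(3) by (metis sym sym_edges_iff trans)
  qed simp
  have rest: "(x # w, x # edge_act (a, b) w) \<in> ?R"
    if "x \<in> V" "(a, b) \<in> E" "w \<in> schreier_verts V n" for x w a b
  proof -
    have ab: "a \<in> V" "b \<in> V" using that EV by auto
    have w': "edge_act (a, b) w \<in> schreier_verts V n"
      using edge_act_in_schreier_verts ab that by metis
    have "(a # w, b # edge_act (a, b) w) \<in> ?R"
      using act[OF that(2), of "a # w"] that ab by (simp add: Cons_in_schreier_verts)
    then show ?thesis using first[OF that(1) ab(1) that(3)] first[OF ab(2) that(1) w'] trans by blast
  qed
  have tail: "(x # w, x # w') \<in> ?R"
    if "(w, w') \<in> (schreier_adj V E n)\<^sup>*" "x \<in> V" for x w w'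
    using that(1)
  proof induction
    case (step y z)
    then obtain a b where "(a, b) \<in> E" "z = edge_act (a, b) y \<or> y = edge_act (a, b) z"
      "y \<in> schreier_verts V n" "z \<in> schreier_verts V n"
      by (auto simp: schreier_adj_def)
    then have "(x # y, x # z) \<in> ?R" using rest[OF \<open>x \<in> V\<close>] sym by blast
    with step.IH show ?case by (rule trans)
  qed simp
  from Suc.prems obtain x w where u: "u = x # w" "x \<in> V" "w \<in> schreier_verts V n"
    unfolding schreier_verts_Suc by auto
  from Suc.prems obtain y w' where v: "v = y # w'" "y \<in> V" "w' \<in> schreier_verts V n"
    unfolding schreier_verts_Suc by auto
  show ?case using tail[OF Suc.IH[OF u(3) v(3)] u(2)] first[OF u(2) v(2) v(3)] trans u(1) v(1) by blast
qed

section \<open>Binary coding of the cycles\<close>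

section \<open>The odometer\<close>

fun bval :: "'a \<Rightarrow> 'a list \<Rightarrow> int" where
  "bval t [] = 0"
| "bval t (x # w) = of_bool (x = t) + 2 * bval t w"

text \<open>The little-endian binary expansion of \<open>i\<close> modulo \<open>2 ^ m\<close>, with digits \<open>s\<close> for 0 and \<open>t\<close> for 1.\<close>
fun bword :: "'a \<Rightarrow> 'a \<Rightarrow> nat \<Rightarrow> int \<Rightarrow> 'a list" where
  "bword s t 0 i = []"
| "bword s t (Suc m) i = (if odd i then t else s) # bword s t m (i div 2)"

lemma length_bword [simp]: "length (bword s t m i) = m"
  by (induction m arbitrary: i) auto

lemma set_bword: "set (bword s t m i) \<subseteq> {s, t}"
  by (induction m arbitrary: i) auto

lemma bval_bword: "s \<noteq> t \<Longrightarrow> bval t (bword s t m i) = i mod 2 ^ m"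
proof (induction m arbitrary: i)
  case (Suc m)
  have "i mod (2 * 2 ^ m) = 2 * (i div 2 mod 2 ^ m) + i mod 2"
    by (rule zmod_zmult2_eq) simp
  with Suc show ?case by (auto simp: odd_iff_mod_2_eq_one even_iff_mod_2_eq_zero)
qed simp

lemma bword_bval: "s \<noteq> t \<Longrightarrow> set p \<subseteq> {s, t} \<Longrightarrow> bword s t (length p) (bval t p) = p"
  by (induction p) auto

text \<open>Both words have the same value, which determines a word over the two digits. Positions
  on a cycle may thus be arbitrary integers, negative ones included.\<close>

lemma bword_cong:
  assumes "s \<noteq> t" "i mod 2 ^ m = j mod 2 ^ m"
  shows "bword s t m i = bword s t m j"
  using bword_bval[OF assms(1) set_bword, of m i] bword_bval[OF assms(1) set_bword, of m j] assms
  by (simp add: bval_bword)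

text \<open>With \<open>s\<close> as digit 0 and \<open>t\<close> as digit 1, the recursion is
  subtraction of 1 with borrow: it continues after a 0 and stops after a 1.\<close>

lemma edge_act_bword: "s \<noteq> t \<Longrightarrow> edge_act (s, t) (bword s t m i) = bword s t m (i - 1)"
proof (induction m arbitrary: i)
  case (Suc m)
  show ?case
  proof (cases "even i")
    case True
    then have "(i - 1) div 2 = i div 2 - 1" by presburger
    with True Suc show ?thesis by auto
  next
    case False
    then have "(i - 1) div 2 = i div 2" by presburger
    with False Suc show ?thesis by auto
  qed
qed simp

lemma bval_snoc: "bval t (w @ [x]) = bval t w + of_bool (x = t) * 2 ^ length w"
  by (induction w) (auto simp: algebra_simps)

lemma bval_replicate_0: "s \<noteq> t \<Longrightarrow> bval t (replicate m s) = 0"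
  by (induction m) auto

lemma bval_replicate_1: "bval t (replicate m t) = 2 ^ m - 1"
  by (induction m) auto

lemma sum_bval:
  assumes "s \<noteq> t"
  shows "(\<Sum>p\<in>schreier_verts {s, t} m. g (bval t p)) = (\<Sum>i\<in>{0..<2 ^ m}. g i)"
proof (rule sum.reindex_bij_witness[where i = "bword s t m" and j = "bval t"])
  show "bword s t m (bval t p) = p" if "p \<in> schreier_verts {s, t} m" for p
    using that bword_bval[OF assms, of p] by (simp add: schreier_verts_def)
  then show "bval t p \<in> {0..<2 ^ m}" if "p \<in> schreier_verts {s, t} m" for p
    using that bval_bword[OF assms, of m "bval t p"] pos_mod_bound[of "2 ^ m" "bval t p"] pos_mod_sign[of "2 ^ m" "bval t p"] by simp
  show "bval t (bword s t m i) = i" if "i \<in> {0..<2 ^ m}" for i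
    using that by (simp add: bval_bword assms)
  show "bword s t m i \<in> schreier_verts {s, t} m" for i
    using set_bword[of s t m i] by (simp add: schreier_verts_def)
qed simp

text \<open>The residues below \<open>N\<close> are entered or left only at 0 and \<open>N\<close>,
  and both of these double to a multiple of \<open>2 * N\<close>.\<close>

lemma mod_double_pred:
  fixes D N :: int
  assumes "N > 0" "(D mod (2 * N) < N) \<noteq> ((D - 1) mod (2 * N) < N)"
  shows "2 * N dvd 2 * D"
proof -
  define q r where "q = D div (2 * N)" "r = D mod (2 * N)"
  have D: "D = 2 * N * q + r" and r: "0 \<le> r" "r < 2 * N"
    using assms(1) by (simp_all add: q_r_def)
  have "r = 0 \<or> r = N"
  proof (cases "r = 0")
    case False
    have "(D - 1) mod (2 * N) = (r - 1 + 2 * N * q) mod (2 * N)" by (simp add: D algebra_simps)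
    also have "\<dots> = (r - 1) mod (2 * N)" by (rule mod_mult_self2)
    also have "\<dots> = r - 1" using False r by (intro mod_pos_pos_trivial) auto
    finally show ?thesis using assms(2) r unfolding q_r_def(2)[symmetric] by auto
  qed simp
  then have "D = N * (2 * q) \<or> D = N * (2 * q + 1)" by (auto simp: D algebra_simps)
  then have "N dvd D" by auto
  then show ?thesis by simp
qed

lemma mod_double_shift:
  fixes D N :: int
  assumes "N > 0"
  shows "(D + N) mod (2 * N) < N \<longleftrightarrow> \<not> D mod (2 * N) < N"
proof -
  define q r where "q = D div (2 * N)" "r = D mod (2 * N)"
  have D: "D = 2 * N * q + r" and r: "0 \<le> r" "r < 2 * N"
    using assms(1) by (simp_all add: q_r_def)
  have 1: "(D + N) mod (2 * N) = (r + N) mod (2 * N)"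
  proof -
    have "D + N = (r + N) + 2 * N * q" by (simp add: D)
    then show ?thesis by (metis mod_mult_self2)
  qed
  show ?thesis
  proof (cases "r < N")
    case True
    then have "(r + N) mod (2 * N) = r + N" using r by (intro mod_pos_pos_trivial) auto
    with 1 True r show ?thesis unfolding q_r_def(2)[symmetric] by auto
  next
    case False
    have "(r + N) mod (2 * N) = (r - N + 2 * N) mod (2 * N)" by (simp add: add.commute)
    also have "\<dots> = (r - N) mod (2 * N)" by (rule mod_add_self2)
    also have "\<dots> = r - N" using False r by (intro mod_pos_pos_trivial) auto
    finally show ?thesis using 1 False r unfolding q_r_def(2)[symmetric] by auto
  qed
qed

section \<open>Retractions onto cycles and their reflections\<close>

section \<open>Retraction onto a cycle\<close>

context edge_cut
begin

text \<open>The retraction of the tree onto its edge, which is \<open>retr\<close> on words of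
  length one.\<close>

definition side :: "'a \<Rightarrow> 'a" where
  "side x = (if x \<in> S then s else t)"

text \<open>If the last letter of \<open>w\<close> outside \<open>{s, t}\<close> is \<open>x\<close>, then every letter of \<open>w\<close> up to that
  position is replaced by \<open>side x\<close>. This is the point of the cycle on the words over \<open>{s, t}\<close>
  through which \<open>w\<close> is attached to that cycle.\<close>
fun retr :: "'a list \<Rightarrow> 'a list" where
  "retr [] = []"
| "retr (x # w) = (if set w \<subseteq> {s, t} then side x else hd (retr w)) # retr w"

lemma side_simps [simp]: "side s = s" "side t = t"
  using s_S t_S by (auto simp: side_def)

lemma length_retr [simp]: "length (retr w) = length w"
  by (induction w) auto

lemma retr_eq_Nil [simp]: "retr w = [] \<longleftrightarrow> w = []"
  by (cases w) auto

lemma retr_id: "set w \<subseteq> {s, t} \<Longrightarrow> retr w = w"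
  by (induction w) auto

lemma retr_append_outside:
  "\<not> set w \<subseteq> {s, t} \<Longrightarrow> retr (q @ w) = replicate (length q) (hd (retr w)) @ retr w"
proof (induction q)
  case (Cons x q)
  then have "\<not> set (q @ w) \<subseteq> {s, t}" by auto
  with Cons show ?case by (cases q) auto
qed simp

lemma retr_append_inside:
  "set w \<subseteq> {s, t} \<Longrightarrow> \<forall>x\<in>set q. side x = c \<Longrightarrow> retr (q @ w) = replicate (length q) c @ w"
proof (induction q)
  case Nil
  then show ?case by (simp add: retr_id)
next
  case (Cons x q)
  then show ?case by (cases q) auto
qed

text \<open>Either the prefix is overwritten by a letter determined by \<open>w\<close>, or each of
  its letters becomes \<open>c\<close>.\<close>

lemma retr_prefix_cong:
  assumes "length q = length q'" "\<forall>x\<in>set q \<union> set q'. side x = c"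
  shows "retr (q @ w) = retr (q' @ w)"
  using assms retr_append_outside[of w q] retr_append_outside[of w q']
    retr_append_inside[of w q c] retr_append_inside[of w q' c]
  by (cases "set w \<subseteq> {s, t}") auto

lemma retr_snoc_inside: "x \<in> {s, t} \<Longrightarrow> retr (w @ [x]) = retr w @ [x]"
proof (induction w)
  case (Cons y w)
  then show ?case by (cases "w = []") (auto simp: hd_append)
qed auto

lemma retr_snoc_outside: "x \<notin> {s, t} \<Longrightarrow> retr (w @ [x]) = replicate (Suc (length w)) (side x)"
  by (induction w) auto

lemma retr_replicate: "retr (replicate m x) = replicate m (side x)"
  using retr_append_inside[of "[]" "replicate m x" "side x"] by simp

lemma edge_act_st_inside: "set (edge_act (s, t) w) \<subseteq> {s, t} \<longleftrightarrow> set w \<subseteq> {s, t}"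
  by (induction w) auto

text \<open>The retraction reads only the suffix from the last letter outside \<open>{s, t}\<close>
  on, while the action stops at the first such letter.\<close>

lemma retr_edge_act_st:
  "\<not> set w \<subseteq> {s, t} \<Longrightarrow> retr (edge_act (s, t) w) = retr w"
proof (induction w)
  case (Cons x w)
  then show ?case using edge_act_st_inside[of w] by (cases "set w \<subseteq> {s, t}") auto
qed simp

lemma side_edge: "(a, b) \<in> E \<Longrightarrow> (a, b) \<noteq> (s, t) \<Longrightarrow> side a = side b"
  using same_side by (auto simp: side_def)

lemma retr_edge_act:
  assumes "(a, b) \<in> E" "(a, b) \<noteq> (s, t)"
  shows "retr (edge_act (a, b) w) = retr w"
proof -
  obtain q q' r where q: "w = q @ r" "edge_act (a, b) w = q' @ r" "length q' = length q"
      "set q \<subseteq> {a, b}" "set q' \<subseteq> {a, b}"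
    by (rule edge_act_prefix)
  have "\<forall>x\<in>set q' \<union> set q. side x = side a" using q side_edge[OF assms] by auto
  then show ?thesis using retr_prefix_cong[OF q(3), of "side a" r] q by simp
qed

text \<open>Retraction onto the cycle of all words \<open>p @ y\<close> with \<open>p\<close> a word of length \<open>m\<close>
  over \<open>{s, t}\<close>; the common suffix \<open>y\<close> is dropped from the result.\<close>
definition cyc_retr :: "nat \<Rightarrow> 'a list \<Rightarrow> 'a list \<Rightarrow> 'a list" where
  "cyc_retr m y w = (if drop m w = y then retr (take m w) else replicate m (side (hd y)))"

text \<open>These are exactly the words fixed by \<open>(s, t)\<close>: a carry out of the prefix
  dies here, so the prefix runs through a full cycle.\<close>

definition cyc_suffix :: "'a list \<Rightarrow> bool" where
  "cyc_suffix y \<longleftrightarrow> y = [] \<or> hd y \<notin> {s, t}"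

lemma edge_act_cyc_suffix: "cyc_suffix y \<Longrightarrow> edge_act (s, t) y = y"
  by (cases y) (auto simp: cyc_suffix_def)

lemma edge_act_cycle:
  "cyc_suffix y \<Longrightarrow> edge_act (s, t) (bword s t m i @ y) = bword s t m (i - 1) @ y"
  by (simp add: edge_act_append edge_act_cyc_suffix edge_act_bword s_t)

lemma edge_act_moves_hd: "edge_act (a, b) z \<noteq> z \<Longrightarrow>
   z \<noteq> [] \<and> hd z \<in> {a, b} \<and> edge_act (a, b) z \<noteq> [] \<and> hd (edge_act (a, b) z) \<in> {a, b}"
  by (cases z) (auto split: if_splits)

text \<open>Makes \<open>cyc_retr\<close> collapse every edge of the graph except those of the cycle
  itself. While the suffix is fixed, this is the invariance of \<open>retr\<close> on
  prefixes.\<close>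

lemma cyc_retr_edge_act:
  assumes "(a, b) \<in> E" "cyc_suffix y" "length w = m + length y"
  shows "cyc_retr m y (edge_act (a, b) w) = cyc_retr m y w \<or>
    (\<exists>j. w = bword s t m j @ y \<and> edge_act (a, b) w = bword s t m (j - 1) @ y)"
proof -
  define p z where "p = take m w" "z = drop m w"
  have w: "w = p @ z" and p: "length p = m" using assms(3) by (auto simp: p_z_def)
  define z' where "z' = (if p = replicate m a then edge_act (a, b) z else z)"
  have w': "edge_act (a, b) w = edge_act (a, b) p @ z'"
    by (simp add: w edge_act_append p z'_def)
  have Q: "cyc_retr m y w = (if z = y then retr p else replicate m (side (hd y)))"
    "cyc_retr m y (edge_act (a, b) w) =
       (if z' = y then retr (edge_act (a, b) p) else replicate m (side (hd y)))"
    by (simp_all add: cyc_retr_def w p, simp add: w'[unfolded w] p)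
  show ?thesis
  proof (cases "z' = z")
    case True
    show ?thesis
    proof (cases "z = y \<and> (a, b) = (s, t) \<and> set p \<subseteq> {s, t}")
      case cyc: True
      have "w = bword s t m (bval t p) @ y" using cyc bword_bval[OF s_t] w p by auto
      with edge_act_cycle[OF assms(2)] cyc show ?thesis by metis
    next
      case False
      have "retr (edge_act (a, b) p) = retr p" if "z = y"
      proof (cases "(a, b) = (s, t)")
        case st: True
        with False that show ?thesis using retr_edge_act_st[of p] by auto
      qed (rule retr_edge_act[OF assms(1)])
      then show ?thesis using Q True by auto
    qed
  next
    case False
    \<comment> \<open>A change of suffix needs a carry, hence a prefix \<open>a ... a\<close> turned
      into \<open>b ... b\<close>. If \<open>y\<close> is one of the suffixes, it starts with
      \<open>a\<close> or \<open>b\<close>, so the edge is not \<open>(s, t)\<close> and both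
      prefixes retract to the same constant word.\<close>
    then have pa: "p = replicate m a" and z': "z' = edge_act (a, b) z" and "edge_act (a, b) z \<noteq> z"
      by (auto simp: z'_def split: if_splits)
    have pb: "edge_act (a, b) p = replicate m b" by (simp add: pa edge_act_replicate)
    note mv = edge_act_moves_hd[OF \<open>edge_act (a, b) z \<noteq> z\<close>]
    have "cyc_retr m y (edge_act (a, b) w) = cyc_retr m y w" if "z = y \<or> z' = y"
    proof -
      have y: "y \<noteq> []" "hd y \<in> {a, b}" using mv that z' by auto
      then have "(a, b) \<noteq> (s, t)" using assms(2) by (auto simp: cyc_suffix_def)
      from side_edge[OF assms(1) this] y have "side a = side (hd y)" "side b = side (hd y)" by auto
      then have "retr p = replicate m (side (hd y))"
        "retr (edge_act (a, b) p) = replicate m (side (hd y))"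
        by (simp_all only: pa pb edge_act_replicate retr_replicate)
      then show ?thesis using Q by auto
    qed
    then show ?thesis using Q by auto
  qed
qed

lemma cyc_retr_bword: "cyc_retr m y (bword s t m j @ y) = bword s t m j"
  by (simp add: cyc_retr_def retr_id[OF set_bword])

lemma bword_append_in_schreier_verts:
  "y \<in> schreier_verts V r \<Longrightarrow> bword s t m j @ y \<in> schreier_verts V (m + r)"
  using set_bword[of s t m j] s_V t_V by (auto simp: schreier_verts_def)

text \<open>The half of the cycle on the side of position \<open>i\<close> for the edge joining positions \<open>i\<close>
  and \<open>i - 1\<close>.\<close>
definition window :: "nat \<Rightarrow> int \<Rightarrow> int set" where
  "window m i = {j. (j - i) mod 2 ^ Suc m < 2 ^ m}"

lemma window_mod: "j mod 2 ^ Suc m \<in> window m i \<longleftrightarrow> j \<in> window m i"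
  by (simp add: window_def mod_diff_left_eq del: power_Suc)

text \<open>Only the given edge and its antipode leave the window. At both, \<open>2 * i - j\<close>
  and \<open>j\<close> agree modulo the length of the cycle, so the reflection swaps the end
  points.\<close>

lemma window_cross:
  assumes "(j \<in> window m i) \<noteq> (j - 1 \<in> window m i)"
  shows "bword s t (Suc m) (2 * i - j) = bword s t (Suc m) j"
proof (rule bword_cong[OF s_t])
  have "((j - i) mod (2 * 2 ^ m) < 2 ^ m) \<noteq> ((j - i - 1) mod (2 * 2 ^ m) < 2 ^ m)"
    using assms by (simp add: window_def diff_right_commute)
  then have "2 * 2 ^ m dvd 2 * (j - i)" by (intro mod_double_pred) auto
  then have "2 ^ Suc m dvd (2 * i - j) - j" by (simp add: algebra_simps dvd_diff_commute)
  then show "(2 * i - j) mod 2 ^ Suc m = j mod 2 ^ Suc m" by (simp only: mod_eq_dvd_iff)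
qed

lemma ncloser_cycle:
  fixes i :: int and m r :: nat
  assumes y: "cyc_suffix y" "y \<in> schreier_verts V r"
  defines "n \<equiv> Suc m + r"
  defines "u \<equiv> bword s t (Suc m) i @ y"
  defines "H \<equiv> {w. bval t (cyc_retr (Suc m) y w) \<in> window m i}"
  shows "ncloser (schreier_verts V n) (schreier_adj V E n) u (edge_act (s, t) u)
       = card (schreier_verts V n \<inter> H)" (is ?A)
    and "ncloser (schreier_verts V n) (schreier_adj V E n) (edge_act (s, t) u) u
       = card (schreier_verts V n - H)" (is ?B)
    and "edge_act (s, t) u \<noteq> u" (is ?C)
proof -
  define c where "c j = bword s t (Suc m) j @ y" for j
  define Q where "Q w = bval t (cyc_retr (Suc m) y w)" for w
  \<comment> \<open>Retract onto the cycle, then reflect it so that the positions \<open>i\<close>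
    and \<open>i - 1\<close> are exchanged.\<close>
  define \<rho> where "\<rho> w = c (2 * i - 1 - Q w)" for w
  let ?R = "schreier_adj V E n" and ?W = "schreier_verts V n"
  have c_V: "c j \<in> ?W" for j
    unfolding c_def n_def by (rule bword_append_in_schreier_verts[OF y(2)])
  have c_act: "edge_act (s, t) (c j) = c (j - 1)" for j
    unfolding c_def by (rule edge_act_cycle[OF y(1)])
  have c_adj: "(c j, c (j - 1)) \<in> ?R" "(c (j - 1), c j) \<in> ?R" for j
    using c_act[of j] c_V edge unfolding schreier_adj_def by force+
  have c_cong: "c j = c j'" if "j mod 2 ^ Suc m = j' mod 2 ^ Suc m" for j j'
    using bword_cong[OF s_t that] by (simp add: c_def)
  have Q_c: "Q (c j) = j mod 2 ^ Suc m" for j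
    unfolding Q_def c_def cyc_retr_bword by (rule bval_bword[OF s_t])
  have \<rho>_c: "\<rho> (c j) = c (2 * i - 1 - j)" for j
    unfolding \<rho>_def Q_c by (rule c_cong) (simp add: mod_diff_right_eq del: power_Suc)
  have H_c: "c j \<in> H \<longleftrightarrow> j \<in> window m i" for j
    using Q_c[of j] window_mod unfolding H_def Q_def by (metis mem_Collect_eq)
  have len: "length w = Suc m + length y" if "w \<in> ?W" for w
    using that y(2) by (simp add: schreier_verts_def n_def)
  have step: "Q x = Q z \<or> (\<exists>j. x = c j \<and> z = c (j - 1)) \<or> (\<exists>j. z = c j \<and> x = c (j - 1))"
    if xz: "(x, z) \<in> ?R" for x z
  proof -
    obtain a b where e: "(a, b) \<in> E" "z = edge_act (a, b) x \<or> x = edge_act (a, b) z"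
      and W: "x \<in> ?W" "z \<in> ?W"
      using xz by (auto simp: schreier_adj_def)
    show ?thesis
      using cyc_retr_edge_act[OF e(1) y(1) len[OF W(1)]] cyc_retr_edge_act[OF e(1) y(1) len[OF W(2)]] e(2)
      unfolding Q_def c_def by metis
  qed
  have hom: "\<rho> x = \<rho> z \<or> (\<rho> x, \<rho> z) \<in> ?R" if xz: "(x, z) \<in> ?R" for x z
  proof -
    have "(\<rho> (c j), \<rho> (c (j - 1))) \<in> ?R \<and> (\<rho> (c (j - 1)), \<rho> (c j)) \<in> ?R" for j
      using c_adj[of "2 * i - j"] unfolding \<rho>_c by (simp add: algebra_simps)
    then show ?thesis using step[OF xz] by (auto simp: \<rho>_def)
  qed
  have cross_c: "\<rho> (c j) = c (j - 1) \<and> \<rho> (c (j - 1)) = c j" if "(c j \<in> H) \<noteq> (c (j - 1) \<in> H)" for j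
  proof -
    have win: "(j \<in> window m i) \<noteq> (j - 1 \<in> window m i)" using that by (simp add: H_c)
    have 1: "c (2 * i - j) = c j" unfolding c_def using window_cross[OF win] by simp
    have "c (2 * i - 1 - j) = c ((2 * i - j) - 1)" by (simp add: algebra_simps)
    also have "\<dots> = c (j - 1)" using 1 c_act by metis
    finally have "\<rho> (c j) = c (j - 1)" by (simp add: \<rho>_c)
    moreover have "\<rho> (c (j - 1)) = c j" using 1 unfolding \<rho>_c by (simp add: algebra_simps)
    ultimately show ?thesis ..
  qed
  have cross: "\<rho> x = z \<and> \<rho> z = x" if xz: "(x, z) \<in> ?R" "(x \<in> H) \<noteq> (z \<in> H)" for x z
  proof -
    have "Q x \<noteq> Q z" using xz(2) by (auto simp: H_def Q_def)
    then show ?thesis using step[OF xz(1)] cross_c xz(2) by metis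
  qed
  have u: "u = c i" by (simp add: u_def c_def)
  have \<rho>: "\<rho> (c i) = c (i - 1)" "\<rho> (c (i - 1)) = c i" by (simp_all add: \<rho>_c algebra_simps)
  have inH: "c i \<in> H" by (simp add: H_c window_def)
  \<comment> \<open>The offset of \<open>i - 1\<close> from \<open>i\<close> is the largest residue,
    which belongs to the other half.\<close>
  have "(- 1) mod 2 ^ Suc m = (2 ^ Suc m - 1 :: int)" by (simp add: zmod_minus1)
  moreover have "(1 :: int) \<le> 2 ^ m" by simp
  ultimately have "i - 1 \<notin> window m i" by (simp add: window_def linorder_not_less)
  then have notH: "c (i - 1) \<notin> H" by (simp add: H_c)
  have conn_W: "(x, z) \<in> ?R\<^sup>*" if "x \<in> ?W" "z \<in> ?W" for x z
    using schreier_connected[OF E_V _ that] conn by blast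
  show ?A ?B unfolding u c_act
    using ncloser_reflect[of ?R \<rho> H ?W "c i" "c (i - 1)"] hom cross conn_W \<rho> c_V inH notH
    by blast+
  show ?C using inH notH unfolding u c_act by metis
qed

end

section \<open>Sizes of the halves and contribution of one tree edge\<close>

section \<open>Counting\<close>

context edge_cut
begin

lemma card_S_pos: "card S \<ge> 1" and card_co_S_pos: "card (V - S) \<ge> 1"
proof -
  have "finite S" using S_V finite_V finite_subset by blast
  then have "card S \<noteq> 0" using s_S by auto
  then show "card S \<ge> 1" by simp
  have "card (V - S) \<noteq> 0" using t_S t_V finite_V by auto
  then show "card (V - S) \<ge> 1" by simp
qed

lemma card_V_split: "card V = card S + card (V - S)"
  using card_Diff_subset[of S V] S_V finite_V by (simp add: card_mono finite_subset)

lemma window_shift: "j + 2 ^ m \<in> window m i \<longleftrightarrow> j \<notin> window m i"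
proof -
  show ?thesis using mod_double_shift[of "2 ^ m" "j - i"] by (simp add: window_def diff_add_eq)
qed

lemma window_top: "2 ^ Suc m - 1 \<in> window m i \<longleftrightarrow> - 1 \<in> window m i"
proof -
  have "(- 1) mod 2 ^ Suc m = (2 ^ Suc m - 1 :: int)" by (simp add: zmod_minus1)
  then show ?thesis using window_mod[of "- 1" m i] by simp
qed

text \<open>Split by the last letter \<open>x\<close> of \<open>w\<close>: since the window contains exactly one of \<open>j\<close> and
  \<open>j + 2 ^ m\<close>, the letters \<open>s\<close> and \<open>t\<close> together contribute one word for each proper prefix,
  while every other letter puts the retraction at an end point 0 or -1.\<close>
lemma card_retr_window:
  "card {w \<in> schreier_verts V (Suc m). bval t (retr w) \<in> window m i} =
   card V ^ m * (1 + of_bool (0 \<in> window m i) * (card S - 1)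
                   + of_bool (- 1 \<in> window m i) * (card (V - S) - 1))"
    (is "card ?L = _ * ?c")
proof -
  let ?X = "\<lambda>w. {x \<in> V. bval t (retr (w @ [x])) \<in> window m i}"
  have "?L = (\<lambda>(w, x). w @ [x]) ` Sigma (schreier_verts V m) ?X"
    unfolding schreier_verts_Suc_snoc by auto
  then have "card ?L = card (Sigma (schreier_verts V m) ?X)"
    by (simp add: card_image inj_on_def)
  also have "\<dots> = (\<Sum>w\<in>schreier_verts V m. card (?X w))"
    using finite_V finite_schreier_verts by (intro card_SigmaI) auto
  also have "\<dots> = (\<Sum>w\<in>schreier_verts V m. ?c)"
  proof (rule sum.cong[OF refl])
    fix w
    assume "w \<in> schreier_verts V m"
    then have w: "length w = m" by (simp add: schreier_verts_def)
    define j where "j = bval t (retr w)"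
    let ?A = "if j \<in> window m i then {s} else {t}"
    let ?B = "if 0 \<in> window m i then S - {s} else {}"
    let ?C = "if - 1 \<in> window m i then V - S - {t} else {}"
    have s: "bval t (retr (w @ [s])) \<in> window m i \<longleftrightarrow> j \<in> window m i"
      using retr_snoc_inside[of s w] s_t by (simp add: bval_snoc j_def)
    have t: "bval t (retr (w @ [t])) \<in> window m i \<longleftrightarrow> j \<notin> window m i"
      using retr_snoc_inside[of t w] s_t by (simp add: bval_snoc j_def w window_shift)
    have xs: "bval t (retr (w @ [x])) \<in> window m i \<longleftrightarrow> 0 \<in> window m i" if "x \<in> S" "x \<noteq> s" for x
    proof -
      have "x \<notin> {s, t}" "side x = s" using that t_S by (auto simp: side_def)
      then show ?thesis using retr_snoc_outside[of x w] bval_replicate_0[OF s_t, of "Suc m"] w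
        by simp
    qed
    have xt: "bval t (retr (w @ [x])) \<in> window m i \<longleftrightarrow> - 1 \<in> window m i" if "x \<notin> S" "x \<noteq> t" for x
    proof -
      have "x \<notin> {s, t}" "side x = t" using that s_S by (auto simp: side_def)
      then have "bval t (retr (w @ [x])) = 2 ^ Suc m - 1"
        using retr_snoc_outside[of x w] bval_replicate_1[of t "Suc m"] w by simp
      then show ?thesis by (simp only: window_top)
    qed
    have "?X w = ?A \<union> ?B \<union> ?C"
    proof (rule set_eqI)
      fix x
      consider "x = s" | "x = t" | "x \<in> S" "x \<noteq> s" "x \<noteq> t" | "x \<notin> S" "x \<noteq> t" "x \<noteq> s" by blast
      then show "x \<in> ?X w \<longleftrightarrow> x \<in> ?A \<union> ?B \<union> ?C"
        by cases (use s t xs[of x] xt[of x] s_S t_S s_V t_V s_t S_V in auto)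
    qed
    moreover have "card (?A \<union> ?B \<union> ?C) = card ?A + card ?B + card ?C"
    proof -
      have fin: "finite ?A" "finite ?B" "finite ?C"
        using finite_V S_V finite_subset by auto
      have "?A \<inter> ?B = {}" "(?A \<union> ?B) \<inter> ?C = {}" using s_S t_S by auto
      then show ?thesis using fin by (simp add: card_Un_disjoint)
    qed
    moreover have "card ?A = 1" by simp
    moreover have "card ?B = of_bool (0 \<in> window m i) * (card S - 1)" using s_S by simp
    moreover have "card ?C = of_bool (- 1 \<in> window m i) * (card (V - S) - 1)"
      using t_S t_V by simp
    ultimately show "card (?X w) = ?c" by simp
  qed
  also have "\<dots> = card V ^ m * ?c" by (simp add: card_schreier_verts finite_V)
  finally show ?thesis .
qed

text \<open>Words ending in \<open>y\<close> are counted by their prefixes; all others retract to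
  one end point and count together or not at all. For \<open>y = []\<close> there are no others, so
  the value of \<open>hd []\<close> does not matter.\<close>

lemma card_cyc_retr_window:
  fixes m r :: nat
  assumes y: "y \<in> schreier_verts V r"
  defines "n \<equiv> Suc m + r"
  shows "card (schreier_verts V n \<inter> {w. bval t (cyc_retr (Suc m) y w) \<in> window m i}) =
   card V ^ m * (1 + of_bool (0 \<in> window m i) * (card S - 1)
                   + of_bool (- 1 \<in> window m i) * (card (V - S) - 1))
   + of_bool ((if hd y \<in> S then 0 else - 1) \<in> window m i) * (card V ^ n - card V ^ Suc m)"
    (is "card ?L = ?c + of_bool ?h * _")
proof -
  let ?W = "schreier_verts V (Suc m)"
  let ?P = "{p \<in> ?W. bval t (retr p) \<in> window m i}"
  let ?D = "schreier_verts V n - (\<lambda>p. p @ y) ` ?W"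
  have fin: "finite (schreier_verts V n)" "finite ?W" using finite_V finite_schreier_verts by auto
  have sub: "(\<lambda>p. p @ y) ` ?W \<subseteq> schreier_verts V n"
    using y by (auto simp: schreier_verts_def n_def)
  have h: "bval t (replicate (Suc m) (side (hd y))) \<in> window m i \<longleftrightarrow> ?h"
  proof (cases "hd y \<in> S")
    case True
    then show ?thesis using bval_replicate_0[OF s_t, of "Suc m"] by (simp add: side_def)
  next
    case False
    then show ?thesis using window_top[of m i]
      by (simp add: side_def bval_replicate_1 del: replicate_Suc power_Suc)
  qed
  have iff: "w \<in> ?L \<longleftrightarrow> w \<in> (\<lambda>p. p @ y) ` ?P \<union> (if ?h then ?D else {})" for w
  proof (cases "w \<in> schreier_verts V n")
    case w: True
    show ?thesis
    proof (cases "drop (Suc m) w = y")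
      case True
      define p where "p = take (Suc m) w"
      have wp: "w = p @ y" using True by (metis append_take_drop_id p_def)
      have p: "p \<in> ?W" using w wp y by (auto simp: schreier_verts_def n_def)
      then have "length p = Suc m" by (simp add: schreier_verts_def)
      then have "cyc_retr (Suc m) y w = retr p" by (simp add: cyc_retr_def wp)
      then show ?thesis using w wp p by auto
    next
      case False
      then have "w \<notin> (\<lambda>p. p @ y) ` ?W" by (auto simp: schreier_verts_def)
      then show ?thesis using w h False by (auto simp: cyc_retr_def)
    qed
  next
    case False
    then show ?thesis using sub by auto
  qed
  have inj: "inj_on (\<lambda>p. p @ y) A" for A by (simp add: inj_on_def)
  have "card ?L = card ((\<lambda>p. p @ y) ` ?P \<union> (if ?h then ?D else {}))"
    using iff by (metis (lifting) set_eqI)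
  also have "\<dots> = card ((\<lambda>p. p @ y) ` ?P) + card (if ?h then ?D else {})"
    using fin by (intro card_Un_disjoint) auto
  also have "card ((\<lambda>p. p @ y) ` ?P) = ?c"
    unfolding card_image[OF inj] by (rule card_retr_window)
  also have "card ?D = card V ^ n - card V ^ Suc m"
    using sub fin by (simp add: card_Diff_subset card_image[OF inj] card_schreier_verts finite_V
      del: power_Suc)
  then have "card (if ?h then ?D else {}) = of_bool ?h * (card V ^ n - card V ^ Suc m)" by simp
  finally show ?thesis .
qed

text \<open>The window runs cyclically from \<open>i\<close> to \<open>i + 2 ^ m - 1\<close>; it
  contains 0 by starting there or by wrapping around.\<close>

lemma window_0:
  assumes "0 \<le> i" "i < 2 ^ Suc m"
  shows "0 \<in> window m i \<longleftrightarrow> i = 0 \<or> 2 ^ m < i"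
proof (cases "i = 0")
  case False
  have "(0 - i) mod 2 ^ Suc m = (2 ^ Suc m - i) mod 2 ^ Suc m"
    by (metis diff_add_eq diff_0 mod_add_self1 add_uminus_conv_diff)
  also have "\<dots> = 2 ^ Suc m - i" using assms False by (intro mod_pos_pos_trivial) auto
  finally show ?thesis using False by (auto simp: window_def)
qed (simp add: window_def)

lemma window_minus_1:
  assumes "0 \<le> i" "i < 2 ^ Suc m"
  shows "- 1 \<in> window m i \<longleftrightarrow> 2 ^ m \<le> i"
proof -
  have "2 ^ Suc m - 1 - i = (2 ^ Suc m - 1 - i) mod 2 ^ Suc m"
    using assms by (intro mod_pos_pos_trivial[symmetric]) auto
  then have "2 ^ Suc m - 1 \<in> window m i \<longleftrightarrow> 2 ^ m \<le> i" by (auto simp: window_def)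
  then show ?thesis by (simp only: window_top)
qed

definition edge_prod :: "nat \<Rightarrow> 'a list \<Rightarrow> nat" where
  "edge_prod n u = (if edge_act (s, t) u = u then 0
     else ncloser (schreier_verts V n) (schreier_adj V E n) u (edge_act (s, t) u) *
          ncloser (schreier_verts V n) (schreier_adj V E n) (edge_act (s, t) u) u)"

text \<open>The edges at 0 and \<open>2 ^ m\<close> separate \<open>s ... s\<close> from
  \<open>t ... t\<close>. For any other edge one half avoids both words, and \<open>k ^ m\<close>
  words retract to it. For nonempty \<open>y\<close>, \<open>c\<close> is the size of the component
  without \<open>hd y\<close>.\<close>

lemma edge_prod_cycle:
  fixes i :: int and m r :: nat and y :: "'a list"
  assumes y: "cyc_suffix y" "y \<in> schreier_verts V r" and i: "0 \<le> i" "i < 2 ^ Suc m"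
  defines "k \<equiv> real (card V)" and "n \<equiv> Suc m + r"
    and "c \<equiv> real (if hd y \<in> S then card (V - S) else card S)"
  shows "real (edge_prod n (bword s t (Suc m) i @ y)) =
    (if i = 0 \<or> i = 2 ^ m then c * k ^ m * (k ^ n - c * k ^ m) else k ^ m * (k ^ n - k ^ m))"
proof -
  let ?H = "{w. bval t (cyc_retr (Suc m) y w) \<in> window m i}"
  let ?W = "schreier_verts V n"
  define a b where ab: "a = real (card S)" "b = real (card (V - S))"
  have k: "k = a + b" by (simp add: k_def ab card_V_split)
  define h where "h = card (?W \<inter> ?H)"
  have finW: "finite ?W" by (simp add: finite_V finite_schreier_verts)
  have "card (?W - ?H) = card ?W - h"
    unfolding h_def using finW by (metis card_Diff_subset_Int finite_Int)
  moreover have "h \<le> card ?W" unfolding h_def by (intro card_mono finW) auto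
  ultimately have co: "real (card (?W - ?H)) = k ^ n - real h"
    by (simp add: card_schreier_verts finite_V k_def)
  have prod: "real (edge_prod n (bword s t (Suc m) i @ y)) = real h * (k ^ n - real h)"
    using ncloser_cycle[OF y, of m i] co by (simp add: edge_prod_def n_def h_def)
  have "card V ^ Suc m \<le> card V ^ n"
    using card_V_split card_S_pos unfolding n_def by (intro power_increasing) auto
  then have X: "real (card V ^ n - card V ^ Suc m) = k ^ n - k ^ Suc m"
    by (simp add: k_def of_nat_diff del: power_Suc)
  have ab': "real (card S - 1) = a - 1" "real (card (V - S) - 1) = b - 1"
    using card_S_pos card_co_S_pos by (simp_all add: ab of_nat_diff)
  have h: "real h = k ^ m * (1 + of_bool (0 \<in> window m i) * (a - 1)
                   + of_bool (- 1 \<in> window m i) * (b - 1))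
      + of_bool ((if hd y \<in> S then 0 else - 1) \<in> window m i) * (k ^ n - k ^ Suc m)"
    unfolding h_def n_def card_cyc_retr_window[OF y(2)]
    by (simp only: of_nat_add of_nat_mult of_nat_power of_nat_of_bool of_nat_1 ab' X[unfolded n_def]
      k_def[symmetric])
  have p: "(0::int) < 2 ^ m" by simp
  consider "i = 0" | "0 < i" "i < 2 ^ m" | "i = 2 ^ m" | "2 ^ m < i" using i by linarith
  then show ?thesis
  proof cases
    case 1
    then have "0 \<in> window m i" "- 1 \<notin> window m i"
      using window_0[OF i] window_minus_1[OF i] p by auto
    with h have "real h = k ^ m * a + of_bool (hd y \<in> S) * (k ^ n - k ^ Suc m)" by simp
    \<comment> \<open>All words with another suffix fall on one side, so one of the two sides has
      size \<open>c * k ^ m\<close>; the product does not see which.\<close>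
    then have "real h = c * k ^ m \<or> real h = k ^ n - c * k ^ m"
      by (cases "hd y \<in> S") (auto simp: c_def ab k algebra_simps)
    then show ?thesis unfolding prod using 1 by auto
  next
    case 2
    then have "0 \<notin> window m i" "- 1 \<notin> window m i"
      using window_0[OF i] window_minus_1[OF i] p by auto
    with h have "real h = k ^ m" by simp
    then show ?thesis unfolding prod using 2 by simp
  next
    case 3
    then have "0 \<notin> window m i" "- 1 \<in> window m i"
      using window_0[OF i] window_minus_1[OF i] p by auto
    with h have "real h = k ^ m * b + of_bool (hd y \<notin> S) * (k ^ n - k ^ Suc m)" by simp
    then have "real h = c * k ^ m \<or> real h = k ^ n - c * k ^ m"
      by (cases "hd y \<in> S") (auto simp: c_def ab k algebra_simps)
    then show ?thesis unfolding prod using 3 by auto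
  next
    case 4
    then have "0 \<in> window m i" "- 1 \<in> window m i"
      using window_0[OF i] window_minus_1[OF i] p by auto
    with h have "real h = k ^ n - k ^ m"
      by (cases "hd y \<in> S") (simp_all add: k algebra_simps)
    moreover have "i \<noteq> 0" "i \<noteq> 2 ^ m" using 4 p by linarith+
    ultimately show ?thesis unfolding prod by simp
  qed
qed

lemma sum_edge_prod_cycle:
  fixes m r :: nat and y :: "'a list"
  assumes y: "cyc_suffix y" "y \<in> schreier_verts V r"
  defines "k \<equiv> real (card V)" and "n \<equiv> Suc m + r"
    and "c \<equiv> real (if hd y \<in> S then card (V - S) else card S)"
  shows "(\<Sum>p\<in>schreier_verts {s, t} (Suc m). real (edge_prod n (p @ y))) =
    2 * (c * k ^ m * (k ^ n - c * k ^ m)) + (2 ^ Suc m - 2) * (k ^ m * (k ^ n - k ^ m))"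
    (is "_ = 2 * ?A + _ * ?B")
proof -
  let ?g = "\<lambda>i::int. if i = 0 \<or> i = 2 ^ m then ?A else ?B"
  let ?I = "{0..<2 ^ Suc m} :: int set"
  have "(\<Sum>p\<in>schreier_verts {s, t} (Suc m). real (edge_prod n (p @ y)))
      = (\<Sum>p\<in>schreier_verts {s, t} (Suc m).
          real (edge_prod n (bword s t (Suc m) (bval t p) @ y)))"
  proof (rule sum.cong[OF refl])
    fix p
    assume "p \<in> schreier_verts {s, t} (Suc m)"
    then have "bword s t (Suc m) (bval t p) = p"
      using bword_bval[OF s_t, of p] by (simp add: schreier_verts_def del: bword.simps)
    then show "real (edge_prod n (p @ y)) = real (edge_prod n (bword s t (Suc m) (bval t p) @ y))"
      by (simp only:)
  qed
  also have "\<dots> = (\<Sum>i\<in>?I. real (edge_prod n (bword s t (Suc m) i @ y)))"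
    by (rule sum_bval[OF s_t])
  also have "\<dots> = (\<Sum>i\<in>?I. ?g i)"
    using edge_prod_cycle[OF y, of _ m] unfolding k_def n_def c_def by (intro sum.cong refl) auto
  \<comment> \<open>For \<open>m = 0\<close> the cycle is a double edge, and the two exceptional
    positions are all of it.\<close>
  also have "\<dots> = (\<Sum>i\<in>?I - {0, 2 ^ m}. ?g i) + (\<Sum>i\<in>{0, 2 ^ m}. ?g i)"
    by (rule sum.subset_diff) auto
  also have "(\<Sum>i\<in>?I - {0, 2 ^ m}. ?g i) = (\<Sum>i\<in>?I - {0, 2 ^ m}. ?B)"
    by (intro sum.cong) auto
  also have "\<dots> = (2 ^ Suc m - 2) * ?B"
  proof -
    have "{0, 2 ^ m} \<subseteq> ?I" by auto
    then have "card (?I - {0, 2 ^ m}) = card ?I - card {0, 2 ^ m :: int}"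
      by (intro card_Diff_subset) auto
    moreover have "card ?I = 2 ^ Suc m" by (simp add: nat_power_eq del: power_Suc)
    ultimately have "card (?I - {0, 2 ^ m}) = 2 ^ Suc m - 2" by simp
    then show ?thesis by (simp add: of_nat_diff)
  qed
  also have "(\<Sum>i\<in>{0, 2 ^ m}. ?g i) = 2 * ?A" by simp
  finally show ?thesis by simp
qed

text \<open>A cycle with suffix \<open>x # z\<close> allows \<open>k ^ (n - Suc m)\<close> words
  \<open>z\<close>, with \<open>a - 1\<close> letters \<open>x\<close> on the side of
  \<open>s\<close> and \<open>b - 1\<close> on the side of \<open>t\<close>. The size of the
  opposite side enters \<open>f\<close>.\<close>

lemma sum_edge_prod:
  fixes n :: nat
  defines "k \<equiv> real (card V)" and "a \<equiv> real (card S)" and "b \<equiv> real (card (V - S))"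
  defines "f \<equiv> \<lambda>c m. 2 * (c * k ^ m * (k ^ Suc n - c * k ^ m))
                   + (2 ^ Suc m - 2) * (k ^ m * (k ^ Suc n - k ^ m))"
  shows "(\<Sum>u\<in>schreier_verts V (Suc n). real (edge_prod (Suc n) u)) =
    f b n + (\<Sum>m<n. k ^ (n - Suc m) * ((a - 1) * f b m + (b - 1) * f a m))"
proof -
  let ?p = "\<lambda>u. real (edge_prod (Suc n) u)"
  let ?T = "\<lambda>m. \<Sum>p\<in>schreier_verts {s, t} m. \<Sum>x\<in>V - {s, t}.
                 \<Sum>z\<in>schreier_verts V (Suc n - Suc m). ?p (p @ x # z)"
  have k: "k = a + b" by (simp add: k_def a_def b_def card_V_split)
  \<comment> \<open>The longest cycle has the empty suffix, and \<open>hd []\<close> may lie on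
    either side; \<open>k = a + b\<close> makes both values agree.\<close>
  have f_sym: "f a n = f b n" by (simp add: f_def k algebra_simps)
  have full: "(\<Sum>p\<in>schreier_verts {s, t} (Suc n). ?p p) = f b n"
    using sum_edge_prod_cycle[of "[]" 0 n] f_sym
    by (auto simp: cyc_suffix_def schreier_verts_0 f_def k_def a_def b_def split: if_splits)
  \<comment> \<open>A word that starts outside \<open>{s, t}\<close> carries a loop.\<close>
  have T0: "?T 0 = 0"
    by (simp add: schreier_verts_0 edge_prod_def)
  have T: "?T (Suc m) = k ^ (n - Suc m) * ((a - 1) * f b m + (b - 1) * f a m)" if m: "m < n" for m
  proof -
    have "?T (Suc m) = (\<Sum>x\<in>V - {s, t}. \<Sum>p\<in>schreier_verts {s, t} (Suc m).
        \<Sum>z\<in>schreier_verts V (n - Suc m). ?p (p @ x # z))"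
      by (subst sum.swap) simp
    also have "\<dots> = (\<Sum>x\<in>V - {s, t}. \<Sum>z\<in>schreier_verts V (n - Suc m).
        \<Sum>p\<in>schreier_verts {s, t} (Suc m). ?p (p @ x # z))"
      by (intro sum.cong refl sum.swap)
    also have "\<dots> = (\<Sum>x\<in>V - {s, t}. k ^ (n - Suc m) * (if x \<in> S then f b m else f a m))"
    proof (rule sum.cong[OF refl])
      fix x
      assume x: "x \<in> V - {s, t}"
      have "(\<Sum>p\<in>schreier_verts {s, t} (Suc m). ?p (p @ x # z)) = (if x \<in> S then f b m else f a m)"
        if z: "z \<in> schreier_verts V (n - Suc m)" for z
      proof -
        have "x # z \<in> schreier_verts V (n - m)" "cyc_suffix (x # z)"
          using x z m by (auto simp: cyc_suffix_def schreier_verts_def)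
        moreover have "Suc m + (n - m) = Suc n" using m by simp
        ultimately show ?thesis
          using sum_edge_prod_cycle[of "x # z" "n - m" m]
          by (simp add: f_def k_def a_def b_def del: power_Suc)
      qed
      then show "(\<Sum>z\<in>schreier_verts V (n - Suc m). \<Sum>p\<in>schreier_verts {s, t} (Suc m). ?p (p @ x # z))
          = k ^ (n - Suc m) * (if x \<in> S then f b m else f a m)"
        by (simp add: card_schreier_verts finite_V k_def)
    qed
    also have "\<dots> = k ^ (n - Suc m) * (\<Sum>x\<in>V - {s, t}. if x \<in> S then f b m else f a m)"
      by (rule sum_distrib_left[symmetric])
    also have "(\<Sum>x\<in>V - {s, t}. if x \<in> S then f b m else f a m)
        = (\<Sum>x\<in>(V - {s, t}) \<inter> {x. x \<in> S}. f b m) + (\<Sum>x\<in>(V - {s, t}) \<inter> - {x. x \<in> S}. f a m)"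
      by (rule sum.If_cases) (simp add: finite_V)
    also have "(V - {s, t}) \<inter> {x. x \<in> S} = S - {s}" using S_V t_S by auto
    also have "(V - {s, t}) \<inter> - {x. x \<in> S} = V - S - {t}" using s_S by auto
    also have "real (card (S - {s})) = a - 1" using s_S card_S_pos by (simp add: a_def of_nat_diff)
    moreover have "real (card (V - S - {t})) = b - 1"
      using t_S t_V card_co_S_pos by (simp add: b_def of_nat_diff)
    ultimately show ?thesis by simp
  qed
  have "(\<Sum>u\<in>schreier_verts V (Suc n). ?p u)
      = (\<Sum>p\<in>schreier_verts {s, t} (Suc n). ?p p) + (\<Sum>m<Suc n. ?T m)"
    using finite_V s_V t_V by (intro sum_schreier_verts_prefix) auto
  also have "(\<Sum>m<Suc n. ?T m) = (\<Sum>m<n. ?T (Suc m))"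
    unfolding sum.lessThan_Suc_shift T0 by simp
  also have "\<dots> = (\<Sum>m<n. k ^ (n - Suc m) * ((a - 1) * f b m + (b - 1) * f a m))"
    using T by (intro sum.cong refl) simp
  finally show ?thesis using full by simp
qed

end

section \<open>Closed form of the sum over all cycles of one edge\<close>

section \<open>Summation\<close>

text \<open>The closed form with \<open>x\<close>, \<open>z\<close>, \<open>q\<close>,
  \<open>N\<close> for \<open>k ^ n\<close>, \<open>2 ^ n\<close>, \<open>a * b\<close>,
  \<open>n\<close>. Taking \<open>P\<close> and \<open>Q\<close> as inverses makes it
  polynomial.\<close>

lemma cycle_sum_identity:
  fixes k x z q N P Q :: real
  assumes "P * (k - 1) = 1" "Q * (2 * k - 1) = 1"
  shows "k * (2 * (q * x^2) + (2 * z - 2) * (x^2 * (k - 1)))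
      + x * (N * (2 * (k * x * (2 * q - k)) - 2 * (k - 2) * (k * x))
             + (2 * (k - 2) - 2 * (q * (k + 2) - k^2)) * (x - 1) * P
             + 2 * (k - 2) * (k * x) * (z - 1) - 2 * (k - 2) * (z * x - 1) * Q)
    = 4 * (k - 1) * (2 * k^2 - 2 * k - 1) * z * x^2 * Q
      - 4 * (k - 1) * (N + 1) * x^2 * k + 4 * (k + 1) * x^2 - 4 * (k + 1) * k * x * Q
      + (4 * (N + 1) * x^2 * k - 2 * (k^2 + 2) * x^2 * P + 2 * (k + 2) * x * P) * q"
    (is "?L = ?R")
proof -
  \<comment> \<open>The difference is written with explicit cofactors of the two relations for
    \<open>P\<close> and \<open>Q\<close>.\<close>
  have "?L - ?R = (2 * (k + 2) * x * (x - 1) + 2 * q * k * x^2) * (P * (k - 1) - 1)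
      + ((2 * k + 4) * x - 2 * k * (2 * k - 3) * z * x^2) * (Q * (2 * k - 1) - 1)"
    by (simp add: algebra_simps power2_eq_square)
  then show ?thesis using assms by simp
qed

text \<open>The sum splits into geometric series of ratios \<open>k\<close>, \<open>2\<close>,
  \<open>2 * k\<close> and a constant summand, which yields the terms linear in
  \<open>n\<close>.\<close>

lemma cycle_sum_closed_form:
  fixes a b k :: real and n :: nat
  assumes k: "k = a + b" "k > 1"
  defines "f \<equiv> \<lambda>c m. 2 * (c * k ^ m * (k ^ Suc n - c * k ^ m))
                   + (2 ^ Suc m - 2) * (k ^ m * (k ^ Suc n - k ^ m))"
  shows "f b n + (\<Sum>m<n. k ^ (n - Suc m) * ((a - 1) * f b m + (b - 1) * f a m)) =
      2 * (k - 1) * (2 * k^2 - 2 * k - 1) / (k^3 * (2 * k - 1)) * 2 ^ Suc n * k ^ (2 * Suc n)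
    - 4 * (k - 1) / k^2 * real (Suc n) * k ^ (2 * Suc n)
    + 4 * (k + 1) / k^3 * k ^ (2 * Suc n)
    - 4 * (k + 1) / (k * (2 * k - 1)) * k ^ Suc n
    + (4 / k^2 * real (Suc n) * k ^ (2 * Suc n)
       - 2 * (k^2 + 2) / (k^3 * (k - 1)) * k ^ (2 * Suc n)
       + 2 * (k + 2) / (k^2 * (k - 1)) * k ^ Suc n) * (a * b)" (is "?F = ?R")
proof -
  define q x z where "q = a * b" "x = k ^ n" "z = (2::real) ^ n"
  have pos: "k > 0" "k - 1 > 0" "2 * k - 1 > 0" using k by auto
  let ?u = "2 * (k * x * (2 * q - k)) - 2 * (k - 2) * (k * x)"
  let ?v = "2 * (k - 2) - 2 * (q * (k + 2) - k^2)"
  let ?w = "2 * (k - 2) * (k * x)"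
  \<comment> \<open>The extra factor \<open>k\<close> completes
    \<open>k ^ (n - Suc m) * k ^ m\<close> to \<open>k ^ n\<close>, which does not depend on
    \<open>m\<close>.\<close>
  have summand: "k * (k ^ (n - Suc m) * ((a - 1) * f b m + (b - 1) * f a m)) =
      x * (?u + ?v * k ^ m + ?w * 2 ^ m - 2 * (k - 2) * (2 * k) ^ m)" if "m < n" for m
  proof -
    define y where "y = k ^ m"
    have x: "x = k * k ^ (n - Suc m) * y"
      using that unfolding y_def q_x_z_def by (simp flip: power_add power_Suc)
    define p where "p = (2::real) ^ m"
    have f: "f c m = 2 * (c * y * (k * x - c * y)) + (2 * p - 2) * (y * (k * x - y))" for c
      by (simp add: f_def y_def p_def q_x_z_def)
    have e: "(a - 1) * f b m + (b - 1) * f a m =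
        y * (?u + ?v * y + ?w * p - 2 * (k - 2) * (p * y))"
      unfolding f q_x_z_def(1) k(1) by algebra
    have "k * (k ^ (n - Suc m) * (y * Z)) = x * Z" for Z by (simp add: x)
    then show ?thesis unfolding e power_mult_distrib y_def[symmetric] p_def[symmetric] .
  qed
  have gk: "(\<Sum>m<n. k ^ m) = (x - 1) / (k - 1)" using geometric_sum[of k n] k(2)
    by (simp add: q_x_z_def)
  have g2: "(\<Sum>m<n. (2::real) ^ m) = z - 1" using geometric_sum[of "2::real" n]
    by (simp add: q_x_z_def)
  have g2k: "(\<Sum>m<n. (2 * k) ^ m) = (z * x - 1) / (2 * k - 1)" using geometric_sum[of "2 * k" n] k(2)
    by (simp add: q_x_z_def power_mult_distrib)
  have "k * (\<Sum>m<n. k ^ (n - Suc m) * ((a - 1) * f b m + (b - 1) * f a m)) =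
      (\<Sum>m<n. x * (?u + ?v * k ^ m + ?w * 2 ^ m - 2 * (k - 2) * (2 * k) ^ m))"
    unfolding sum_distrib_left using summand by (intro sum.cong) auto
  also have "\<dots> = x * (real n * ?u + ?v * (\<Sum>m<n. k ^ m) + ?w * (\<Sum>m<n. 2 ^ m)
      - 2 * (k - 2) * (\<Sum>m<n. (2 * k) ^ m))"
    by (simp add: sum.distrib sum_subtractf flip: sum_distrib_left)
  finally have S: "k * (\<Sum>m<n. k ^ (n - Suc m) * ((a - 1) * f b m + (b - 1) * f a m)) =
      x * (real n * ?u + ?v * ((x - 1) / (k - 1)) + ?w * (z - 1)
      - 2 * (k - 2) * ((z * x - 1) / (2 * k - 1)))"
    unfolding gk g2 g2k .
  have fb: "f b n = 2 * (q * x^2) + (2 * z - 2) * (x^2 * (k - 1))"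
  proof -
    have "f b n = 2 * (b * x * (k * x - b * x)) + (2 * z - 2) * (x * (k * x - x))"
      by (simp add: f_def q_x_z_def)
    then show ?thesis unfolding q_x_z_def(1) k(1) by algebra
  qed
  have "k ^ (2 * Suc n) = k ^ Suc n * k ^ Suc n" unfolding mult_2 by (rule power_add)
  then have pw: "k ^ (2 * Suc n) = k^2 * x^2" "k ^ Suc n = k * x" "(2::real) ^ Suc n = 2 * z"
    "real (Suc n) = real n + 1"
    by (simp_all add: q_x_z_def power2_eq_square)
  define N where "N = real n"
  define P Q where "P = 1 / (k - 1)" "Q = 1 / (2 * k - 1)"
  have PQ: "P * (k - 1) = 1" "Q * (2 * k - 1) = 1" using pos by (simp_all add: P_Q_def)
  have L: "k * ?F = k * (2 * (q * x^2) + (2 * z - 2) * (x^2 * (k - 1)))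
      + x * (N * ?u + ?v * (x - 1) * P + ?w * (z - 1) - 2 * (k - 2) * (z * x - 1) * Q)"
    unfolding distrib_left[of k "f b n"] S unfolding fb N_def P_Q_def by simp
  have a1: "r / (k^3 * b) = r * (1 / b) / k^3" "r / (k^2 * b) = r * (1 / b) / k^2"
      "r / (k * b) = r * (1 / b) / k" for r b
    by simp_all
  have b1: "r / k^3 * m * (k^2 * y) = r * m * y / k" "r / k^3 * (k^2 * y) = r * y / k"
      "r / k^2 * m * (k^2 * y) = r * m * y" "r / k^2 * (k * y) = r * y / k"
      "r / k * (k * y) = r * y" for r m y
    using pos(1) by (simp_all add: power2_eq_square power3_eq_cube)
  have R: "k * ?R = 4 * (k - 1) * (2 * k^2 - 2 * k - 1) * z * x^2 * Q
      - 4 * (k - 1) * (N + 1) * x^2 * k + 4 * (k + 1) * x^2 - 4 * (k + 1) * k * x * Q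
      + (4 * (N + 1) * x^2 * k - 2 * (k^2 + 2) * x^2 * P + 2 * (k + 2) * x * P) * q"
    unfolding pw N_def[symmetric] q_x_z_def(1)[symmetric] a1 P_Q_def[symmetric] b1
    using pos(1) by (simp add: field_simps)
  have "k * ?F = k * ?R" unfolding L R by (rule cycle_sum_identity[OF PQ])
  then show ?thesis using pos by simp
qed

section \<open>Summation over the edges of the tree\<close>

theorem theorem5p7:
  fixes V :: "'a set" and E :: "('a \<times> 'a) set" and n :: nat and k :: real
  assumes "oriented_tree V E"
    and "n \<ge> 1"
    and "k = real (card V)"
  shows "real (szeged_schreier V E n) =
      2 * (k - 1)^2 * (2 * k^2 - 2 * k - 1) / (k^3 * (2 * k - 1)) * 2^n * k^(2*n)
    - 4 * (k - 1)^2 / k^2 * real n * k^(2*n)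
    + 4 * (k + 1) * (k - 1) / k^3 * k^(2*n)
    - 4 * (k + 1) * (k - 1) / (k * (2 * k - 1)) * k^n
    + (4 / k^2 * real n * k^(2*n)
       - 2 * (k^2 + 2) / (k^3 * (k - 1)) * k^(2*n)
       + 2 * (k + 2) / (k^2 * (k - 1)) * k^n) * real (szeged_tree V E)"
proof -
  obtain n' where n': "n = Suc n'" using assms(2) by (cases n) auto
  have cardE: "real (card E) = k - 1" using oriented_tree_card[OF assms(1)] assms(3) by simp
  define C where "C = 2 * (k - 1) * (2 * k^2 - 2 * k - 1) / (k^3 * (2 * k - 1)) * 2 ^ n * k ^ (2 * n)
    - 4 * (k - 1) / k^2 * real n * k ^ (2 * n)
    + 4 * (k + 1) / k^3 * k ^ (2 * n)
    - 4 * (k + 1) / (k * (2 * k - 1)) * k ^ n"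
  define D where "D = 4 / k^2 * real n * k^(2*n)
       - 2 * (k^2 + 2) / (k^3 * (k - 1)) * k^(2*n)
       + 2 * (k + 2) / (k^2 * (k - 1)) * k^n"
  let ?ab = "\<lambda>(s, t). real (ncloser V (sym_edges E) s t * ncloser V (sym_edges E) t s)"
  let ?g = "\<lambda>u e. if edge_act e u = u then 0
         else ncloser (schreier_verts V n) (schreier_adj V E n) u (edge_act e u) *
              ncloser (schreier_verts V n) (schreier_adj V E n) (edge_act e u) u"
  have edge: "(\<Sum>u\<in>schreier_verts V n. real (?g u e)) = C + D * ?ab e" if "e \<in> E" for e
  proof -
    obtain s t where e: "e = (s, t)" by (cases e)
    have "(s, t) \<in> E" using that e by simp
    from oriented_tree_edge_cut[OF assms(1) this] obtain S where "edge_cut V E s t S" by blast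
    then interpret edge_cut V E s t S .
    have k: "k = real (card S) + real (card (V - S))" using assms(3) card_V_split by simp
    \<comment> \<open>An edge forces two vertices; for a tree with one vertex the sum over
      \<open>E\<close> is empty.\<close>
    then have "k > 1" using card_S_pos card_co_S_pos by linarith
    have "(\<Sum>u\<in>schreier_verts V n. real (?g u e)) = (\<Sum>u\<in>schreier_verts V n. real (edge_prod n u))"
      unfolding e edge_prod_def by (rule refl)
    also have "\<dots> = C + D * (real (card S) * real (card (V - S)))"
      unfolding C_def D_def n' sum_edge_prod assms(3)[symmetric]
      by (rule cycle_sum_closed_form[OF k \<open>k > 1\<close>])
    finally show ?thesis by (simp add: e ncloser_tree)
  qed
  \<comment> \<open>Exchanging the sums lets each tree edge be handled in its own
    \<open>edge_cut\<close>.\<close>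
  have "real (szeged_schreier V E n) = (\<Sum>e\<in>E. \<Sum>u\<in>schreier_verts V n. real (?g u e))"
    unfolding szeged_schreier_def of_nat_sum by (rule sum.swap)
  also have "\<dots> = (\<Sum>e\<in>E. C + D * ?ab e)" using edge by (intro sum.cong) auto
  also have "\<dots> = real (card E) * C + D * (\<Sum>e\<in>E. ?ab e)"
    by (simp add: sum.distrib sum_distrib_left)
  also have "(\<Sum>e\<in>E. ?ab e) = real (szeged_tree V E)"
    unfolding szeged_tree_def of_nat_sum by (intro sum.cong) auto
  finally show ?thesis unfolding cardE C_def D_def
    by (simp add: algebra_simps power2_eq_square)
qed

end
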